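(* Let $H$ be a Hopf algebra with bijective antipode $S$ over a field $k$. Let $\delta: H\to k$ be a character and $\sigma\in H$ a group-like element. Regard $k$ as a right $H$-module via $\delta$, i.e. $m\cdot h=m\,\delta(h)$, and as a left $H$-comodule via $\sigma$, i.e. $m\mapsto \sigma\otimes m$. Then $k$ with this action and coaction is a stable (right module, left comodule) anti-Yetter-Drinfeld module if and only if $(\delta,\sigma)$ is a modular pair in involution.
   Context: Algebras are associative and unital over $k$. Sumless Sweedler notation: $\Delta(h)=h^{(1)}\otimes h^{(2)}$, and for a left coaction ${}_M\Delta(m)=m^{(-1)}\otimes m^{(0)}\in H\otimes M$. A character is a unital algebra homomorphism $\delta:H\to k$; a group-like is $\sigma\in H$ with $\Delta(\sigma)=\sigma\otimes\sigma$, $\varepsilon(\sigma)=1$. A right $H$-module and left $H$-comodule $M$ is an anti-Yetter-Drinfeld module if for all $h\in H$, $m\in M$: ${}_M\Delta(mh)=S(h^{(3)})m^{(-1)}h^{(1)}\otimes m^{(0)}h^{(2)}$. It is stable if $m^{(0)}m^{(-1)}=m$ for all $m\in M$. Modular pair in involution (Connes–Moscovici): a pair $(\delta,\sigma)$ of a character $\delta$ and a group-like $\sigma$ such that $\delta(\sigma)=1$ and, with the twisted antipode $S_\delta(h):=\delta(h^{(1)})S(h^{(2)})$, one has $\sigma^{-1}S_\delta(\sigma^{-1}S_\delta(h))=h$ for all $h\in H$ (equivalently, given $\delta(\sigma)=1$, $S_\delta^2(h)=\sigma h\sigma^{-1}$). *)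

theory Defs
  imports Complex_Main "HOL-Library.Poly_Mapping"
begin

section \<open>Tensor products of vector spaces\<close>

text \<open>
  Throughout, vector spaces over a field \<open>'k\<close> are types of class \<^class>\<open>ab_group_add\<close> with an
  explicit scalar multiplication satisfying \<^locale>\<open>vector_space\<close>. The tensor product \<open>A \<otimes> B\<close> is
  the usual quotient of the free vector space on \<open>A \<times> B\<close>, that is of \<open>'a \<times> 'b \<Rightarrow>\<^sub>0 'k\<close>, by the
  subspace spanned by the bilinear relators; its elements are cosets. The formal sum
  \<open>Poly_Mapping.single (a, b) 1\<close> represents \<open>a \<otimes> b\<close>.
\<close>

definition fscale :: "'k::field \<Rightarrow> ('x \<Rightarrow>\<^sub>0 'k) \<Rightarrow> ('x \<Rightarrow>\<^sub>0 'k)" where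
  "fscale c = Poly_Mapping.map ((*) c)"

text \<open>The linear extension of \<open>f\<close> from the basis \<open>'x\<close> to the free vector space on \<open>'x\<close>.\<close>

definition lin_ext :: "('k::field \<Rightarrow> 'v::ab_group_add \<Rightarrow> 'v) \<Rightarrow> ('x \<Rightarrow> 'v) \<Rightarrow> ('x \<Rightarrow>\<^sub>0 'k) \<Rightarrow> 'v" where
  "lin_ext s f p = (\<Sum>x\<in>Poly_Mapping.keys p. s (Poly_Mapping.lookup p x) (f x))"

text \<open>
  The relators for linearity in one tensor factor; \<open>i\<close> inserts a vector into that factor, the other
  factors being fixed.
\<close>

definition slot_relators ::
  "('k::field \<Rightarrow> 'a::ab_group_add \<Rightarrow> 'a) \<Rightarrow> ('a \<Rightarrow> 'x) \<Rightarrow> ('x \<Rightarrow>\<^sub>0 'k) set" where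
  "slot_relators s i =
     {Poly_Mapping.single (i (x + y)) 1 - Poly_Mapping.single (i x) 1 - Poly_Mapping.single (i y) 1 | x y. True}
     \<union> {Poly_Mapping.single (i (s c x)) 1 - Poly_Mapping.single (i x) c | c x. True}"

definition null2 ::
  "('k::field \<Rightarrow> 'a::ab_group_add \<Rightarrow> 'a) \<Rightarrow> ('k \<Rightarrow> 'b::ab_group_add \<Rightarrow> 'b) \<Rightarrow> ('a \<times> 'b \<Rightarrow>\<^sub>0 'k) set" where
  "null2 sA sB = module.span fscale
     ((\<Union>b. slot_relators sA (\<lambda>a. (a, b))) \<union> (\<Union>a. slot_relators sB (\<lambda>b. (a, b))))"

definition null3 ::
  "('k::field \<Rightarrow> 'a::ab_group_add \<Rightarrow> 'a) \<Rightarrow> ('k \<Rightarrow> 'b::ab_group_add \<Rightarrow> 'b)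
   \<Rightarrow> ('k \<Rightarrow> 'c::ab_group_add \<Rightarrow> 'c) \<Rightarrow> ('a \<times> 'b \<times> 'c \<Rightarrow>\<^sub>0 'k) set" where
  "null3 sA sB sC = module.span fscale
     ((\<Union>b c. slot_relators sA (\<lambda>a. (a, b, c))) \<union> (\<Union>a c. slot_relators sB (\<lambda>b. (a, b, c)))
      \<union> (\<Union>a b. slot_relators sC (\<lambda>c. (a, b, c))))"

text \<open>
  The classes of a formal sum in \<open>A \<otimes> B\<close> and in \<open>A \<otimes> B \<otimes> C\<close>. The threefold tensor product is formed
  directly as the quotient by the trilinear relators, so both bracketings are already identified.
\<close>

definition tensor2 ::
  "('k::field \<Rightarrow> 'a::ab_group_add \<Rightarrow> 'a) \<Rightarrow> ('k \<Rightarrow> 'b::ab_group_add \<Rightarrow> 'b)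
   \<Rightarrow> ('a \<times> 'b \<Rightarrow>\<^sub>0 'k) \<Rightarrow> ('a \<times> 'b \<Rightarrow>\<^sub>0 'k) set" where
  "tensor2 sA sB p = {q. q - p \<in> null2 sA sB}"

definition tensor3 ::
  "('k::field \<Rightarrow> 'a::ab_group_add \<Rightarrow> 'a) \<Rightarrow> ('k \<Rightarrow> 'b::ab_group_add \<Rightarrow> 'b)
   \<Rightarrow> ('k \<Rightarrow> 'c::ab_group_add \<Rightarrow> 'c) \<Rightarrow> ('a \<times> 'b \<times> 'c \<Rightarrow>\<^sub>0 'k) \<Rightarrow> ('a \<times> 'b \<times> 'c \<Rightarrow>\<^sub>0 'k) set" where
  "tensor3 sA sB sC p = {q. q - p \<in> null3 sA sB sC}"

text \<open>A linear map \<open>V \<rightarrow> A \<otimes> B\<close>.\<close>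

definition linear_to_tensor ::
  "('k::field \<Rightarrow> 'v::ab_group_add \<Rightarrow> 'v) \<Rightarrow> ('k \<Rightarrow> 'a::ab_group_add \<Rightarrow> 'a)
   \<Rightarrow> ('k \<Rightarrow> 'b::ab_group_add \<Rightarrow> 'b) \<Rightarrow> ('v \<Rightarrow> ('a \<times> 'b \<Rightarrow>\<^sub>0 'k) set) \<Rightarrow> bool" where
  "linear_to_tensor sV sA sB f \<longleftrightarrow>
     (\<forall>v. f v \<in> range (tensor2 sA sB)) \<and>
     (\<forall>v w. \<forall>p\<in>f v. \<forall>q\<in>f w. p + q \<in> f (v + w)) \<and>
     (\<forall>c v. \<forall>p\<in>f v. fscale c p \<in> f (sV c v))"

text \<open>
  Sweedler notation: \<open>sweedler s f t\<close> is the sum of all \<open>f (t', t'')\<close> where the formal sum of all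
  \<open>(t', t'')\<close> represents \<open>t\<close>. For bilinear \<open>f\<close> the choice of representative is irrelevant, see
  \<open>sweedler_tensor2\<close> below; if \<open>f\<close> takes formal sums as values, bilinearity modulo the relators is
  enough, see \<open>lin_ext_cong_mod\<close>.
\<close>

definition sweedler ::
  "('k::field \<Rightarrow> 'v::ab_group_add \<Rightarrow> 'v) \<Rightarrow> ('x \<Rightarrow> 'v) \<Rightarrow> ('x \<Rightarrow>\<^sub>0 'k) set \<Rightarrow> 'v" where
  "sweedler s f t = lin_ext s f (SOME p. p \<in> t)"

lemma lookup_fscale: "Poly_Mapping.lookup (fscale c p) x = c * Poly_Mapping.lookup p x"
  unfolding fscale_def by (simp add: Poly_Mapping.map.rep_eq when_def)

lemma vector_space_fscale: "vector_space (fscale :: 'k::field \<Rightarrow> ('x \<Rightarrow>\<^sub>0 'k) \<Rightarrow> _)"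
  by unfold_locales (auto intro!: poly_mapping_eqI simp: lookup_fscale lookup_add algebra_simps)

lemma lin_ext_eq_sum:
  assumes "vector_space s" "finite K" "Poly_Mapping.keys p \<subseteq> K"
  shows "lin_ext s f p = (\<Sum>x\<in>K. s (Poly_Mapping.lookup p x) (f x))"
proof -
  interpret vector_space s by fact
  show ?thesis
    unfolding lin_ext_def using assms(2,3)
    by (intro sum.mono_neutral_left) (auto simp: in_keys_iff)
qed

lemma linear_lin_ext:
  fixes s :: "'k::field \<Rightarrow> 'v::ab_group_add \<Rightarrow> 'v" and f :: "'x \<Rightarrow> 'v"
  assumes "vector_space s"
  shows "Vector_Spaces.linear fscale s (lin_ext s f)"
proof -
  interpret A: vector_space s by fact
  show ?thesis
    unfolding Vector_Spaces.linear_iff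
  proof (intro conjI allI vector_space_fscale assms)
    fix p q :: "'x \<Rightarrow>\<^sub>0 'k"
    let ?K = "Poly_Mapping.keys p \<union> Poly_Mapping.keys q"
    have "Poly_Mapping.keys (p + q) \<subseteq> ?K" by (rule keys_add)
    then show "lin_ext s f (p + q) = lin_ext s f p + lin_ext s f q"
      using assms
      by (simp add: lin_ext_eq_sum[of s ?K] lookup_add A.scale_left_distrib sum.distrib)
  next
    fix c and p :: "'x \<Rightarrow>\<^sub>0 'k"
    have "Poly_Mapping.keys (fscale c p) \<subseteq> Poly_Mapping.keys p"
      by (auto simp: in_keys_iff lookup_fscale)
    then show "lin_ext s f (fscale c p) = s c (lin_ext s f p)"
      using assms
      by (simp add: lin_ext_eq_sum[of s "Poly_Mapping.keys p"] lookup_fscale A.scale_sum_right)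
  qed
qed

lemma lin_ext_single [simp]:
  assumes "vector_space s"
  shows "lin_ext s f (Poly_Mapping.single x c) = s c (f x)"
proof -
  interpret vector_space s by fact
  show ?thesis by (simp add: lin_ext_def)
qed

lemma lin_ext_cong_mod:
  fixes s :: "'k::field \<Rightarrow> 'v::ab_group_add \<Rightarrow> 'v" and f :: "'x \<Rightarrow> 'v"
  assumes s: "vector_space s" and N: "module.subspace s N"
    and rel: "\<And>r. r \<in> R \<Longrightarrow> lin_ext s f r \<in> N"
    and pq: "p - q \<in> module.span fscale R"
  shows "lin_ext s f p - lin_ext s f q \<in> N"
proof -
  interpret A: vector_space s by fact
  interpret F: vector_space "fscale :: 'k \<Rightarrow> ('x \<Rightarrow>\<^sub>0 'k) \<Rightarrow> _" by (rule vector_space_fscale)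
  interpret L: Vector_Spaces.linear "fscale :: 'k \<Rightarrow> ('x \<Rightarrow>\<^sub>0 'k) \<Rightarrow> _" s "lin_ext s f"
    by (rule linear_lin_ext[OF s])
  have "lin_ext s f (p - q) \<in> N"
    using pq
  proof (induction rule: F.span_induct_alt)
    case base
    then show ?case using A.subspace_0[OF N] by (simp add: L.zero)
  next
    case (step c x y)
    then show ?case
      using A.subspace_add[OF N] A.subspace_scale[OF N] rel by (simp add: L.add L.scale)
  qed
  then show ?thesis by (simp add: L.diff)
qed

lemma sweedler_tensor2:
  fixes s :: "'k::field \<Rightarrow> 'v::ab_group_add \<Rightarrow> 'v"
    and sA :: "'k \<Rightarrow> 'x::ab_group_add \<Rightarrow> 'x" and sB :: "'k \<Rightarrow> 'y::ab_group_add \<Rightarrow> 'y"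
  assumes s: "vector_space s"
    and f1: "\<And>b. Vector_Spaces.linear sA s (\<lambda>a. f (a, b))"
    and f2: "\<And>a. Vector_Spaces.linear sB s (\<lambda>b. f (a, b))"
  shows "sweedler s f (tensor2 sA sB p) = lin_ext s f p"
proof -
  interpret A: vector_space s by fact
  interpret F: vector_space "fscale :: 'k \<Rightarrow> ('x \<times> 'y \<Rightarrow>\<^sub>0 'k) \<Rightarrow> _" by (rule vector_space_fscale)
  interpret L: Vector_Spaces.linear "fscale :: 'k \<Rightarrow> ('x \<times> 'y \<Rightarrow>\<^sub>0 'k) \<Rightarrow> _" s "lin_ext s f"
    by (rule linear_lin_ext[OF s])
  let ?q = "SOME q. q \<in> tensor2 sA sB p"
  have "p \<in> tensor2 sA sB p"
    by (simp add: tensor2_def null2_def F.span_zero)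
  then have "?q \<in> tensor2 sA sB p" by (rule someI)
  then have "?q - p \<in> null2 sA sB" by (simp add: tensor2_def)
  then have "lin_ext s f ?q - lin_ext s f p \<in> {0}"
    unfolding null2_def
  proof (rule lin_ext_cong_mod[OF s, rotated 2])
    fix r
    assume r: "r \<in> (\<Union>b. slot_relators sA (\<lambda>a. (a, b))) \<union> (\<Union>a. slot_relators sB (\<lambda>b. (a, b)))"
    have "f (x + y, b) = f (x, b) + f (y, b)" "f (sA c x, b) = s c (f (x, b))" for x y b c
      using f1[of b] by (simp_all add: Vector_Spaces.linear_iff)
    moreover have "f (a, x + y) = f (a, x) + f (a, y)" "f (a, sB c x) = s c (f (a, x))" for x y a c
      using f2[of a] by (simp_all add: Vector_Spaces.linear_iff)
    ultimately show "lin_ext s f r \<in> {0}"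
      using r s by (auto simp: slot_relators_def L.diff)
  qed (rule A.subspace_single_0)
  then show ?thesis by (simp add: sweedler_def)
qed


section \<open>Hopf algebras\<close>

text \<open>
  The algebra structure is that of the type \<open>'h\<close>. In coassociativity and multiplicativity of the
  comultiplication, formal sums in the free vector space stand for the corresponding elements of
  \<open>H \<otimes> H \<otimes> H\<close> and \<open>H \<otimes> H\<close>.
\<close>

locale hopf_algebra = vector_space scale
  for scale :: "'k::field \<Rightarrow> 'h::ring_1 \<Rightarrow> 'h" +
  fixes comult :: "'h \<Rightarrow> ('h \<times> 'h \<Rightarrow>\<^sub>0 'k) set"
    and counit :: "'h \<Rightarrow> 'k"
    and antipode :: "'h \<Rightarrow> 'h"
  assumes scale_mult_left: "scale c x * y = scale c (x * y)"
    and scale_mult_right: "x * scale c y = scale c (x * y)"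
    and comult_linear: "linear_to_tensor scale scale scale comult"
    and counit_linear: "Vector_Spaces.linear scale (*) counit"
    and coassoc:
      "tensor3 scale scale scale
         (sweedler fscale (\<lambda>(a, b). sweedler fscale (\<lambda>(a1, a2). Poly_Mapping.single (a1, a2, b) 1) (comult a)) (comult x))
       = tensor3 scale scale scale
         (sweedler fscale (\<lambda>(a, b). sweedler fscale (\<lambda>(b1, b2). Poly_Mapping.single (a, b1, b2) 1) (comult b)) (comult x))"
    and counit_left: "sweedler scale (\<lambda>(a, b). scale (counit a) b) (comult x) = x"
    and counit_right: "sweedler scale (\<lambda>(a, b). scale (counit b) a) (comult x) = x"
    and comult_mult:
      "comult (x * y) = tensor2 scale scale
         (sweedler fscale (\<lambda>(a, b). sweedler fscale (\<lambda>(c, d). Poly_Mapping.single (a * c, b * d) 1) (comult y)) (comult x))"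
    and comult_one: "comult 1 = tensor2 scale scale (Poly_Mapping.single (1, 1) 1)"
    and counit_mult: "counit (x * y) = counit x * counit y"
    and counit_one: "counit 1 = 1"
    and antipode_linear: "Vector_Spaces.linear scale scale antipode"
    and antipode_left: "sweedler scale (\<lambda>(a, b). antipode a * b) (comult x) = scale (counit x) 1"
    and antipode_right: "sweedler scale (\<lambda>(a, b). a * antipode b) (comult x) = scale (counit x) 1"

definition character :: "('k::field \<Rightarrow> 'h::ring_1 \<Rightarrow> 'h) \<Rightarrow> ('h \<Rightarrow> 'k) \<Rightarrow> bool" where
  "character scale \<delta> \<longleftrightarrow> Vector_Spaces.linear scale (*) \<delta> \<and> \<delta> 1 = 1 \<and> (\<forall>x y. \<delta> (x * y) = \<delta> x * \<delta> y)"

definition group_like ::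
  "('k::field \<Rightarrow> 'h::ring_1 \<Rightarrow> 'h) \<Rightarrow> ('h \<Rightarrow> ('h \<times> 'h \<Rightarrow>\<^sub>0 'k) set) \<Rightarrow> ('h \<Rightarrow> 'k) \<Rightarrow> 'h \<Rightarrow> bool" where
  "group_like scale comult counit \<sigma> \<longleftrightarrow>
     comult \<sigma> = tensor2 scale scale (Poly_Mapping.single (\<sigma>, \<sigma>) 1) \<and> counit \<sigma> = 1"


section \<open>Stable anti-Yetter-Drinfeld modules\<close>

locale hopf_right_module =
  hopf_algebra scale comult counit antipode + M: vector_space scaleM
  for scale :: "'k::field \<Rightarrow> 'h::ring_1 \<Rightarrow> 'h"
    and comult :: "'h \<Rightarrow> ('h \<times> 'h \<Rightarrow>\<^sub>0 'k) set" and counit :: "'h \<Rightarrow> 'k" and antipode :: "'h \<Rightarrow> 'h"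
    and scaleM :: "'k \<Rightarrow> 'm::ab_group_add \<Rightarrow> 'm" +
  fixes act :: "'m \<Rightarrow> 'h \<Rightarrow> 'm"
  assumes act_linear_left: "Vector_Spaces.linear scaleM scaleM (\<lambda>m. act m h)"
    and act_linear_right: "Vector_Spaces.linear scale scaleM (act m)"
    and act_one: "act m 1 = m"
    and act_mult: "act m (g * h) = act (act m g) h"

locale hopf_left_comodule =
  hopf_algebra scale comult counit antipode + M: vector_space scaleM
  for scale :: "'k::field \<Rightarrow> 'h::ring_1 \<Rightarrow> 'h"
    and comult :: "'h \<Rightarrow> ('h \<times> 'h \<Rightarrow>\<^sub>0 'k) set" and counit :: "'h \<Rightarrow> 'k" and antipode :: "'h \<Rightarrow> 'h"
    and scaleM :: "'k \<Rightarrow> 'm::ab_group_add \<Rightarrow> 'm" +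
  fixes coact :: "'m \<Rightarrow> ('h \<times> 'm \<Rightarrow>\<^sub>0 'k) set"
  assumes coact_linear: "linear_to_tensor scaleM scale scaleM coact"
    and coact_coassoc:
      "tensor3 scale scale scaleM
         (sweedler fscale (\<lambda>(a, n). sweedler fscale (\<lambda>(a1, a2). Poly_Mapping.single (a1, a2, n) 1) (comult a)) (coact m))
       = tensor3 scale scale scaleM
         (sweedler fscale (\<lambda>(a, n). sweedler fscale (\<lambda>(b, n'). Poly_Mapping.single (a, b, n') 1) (coact n)) (coact m))"
    and coact_counit: "sweedler scaleM (\<lambda>(a, n). scaleM (counit a) n) (coact m) = m"

text \<open>
  In the compatibility condition \<open>h1 \<otimes> h2 \<otimes> h3\<close> is obtained by applying the comultiplication to
  the first leg \<open>h12\<close> of \<open>\<Delta>(h)\<close>.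
\<close>

locale anti_yetter_drinfeld_module =
  hopf_right_module scale comult counit antipode scaleM act +
  hopf_left_comodule scale comult counit antipode scaleM coact
  for scale :: "'k::field \<Rightarrow> 'h::ring_1 \<Rightarrow> 'h"
    and comult :: "'h \<Rightarrow> ('h \<times> 'h \<Rightarrow>\<^sub>0 'k) set" and counit :: "'h \<Rightarrow> 'k" and antipode :: "'h \<Rightarrow> 'h"
    and scaleM :: "'k \<Rightarrow> 'm::ab_group_add \<Rightarrow> 'm"
    and act :: "'m \<Rightarrow> 'h \<Rightarrow> 'm"
    and coact :: "'m \<Rightarrow> ('h \<times> 'm \<Rightarrow>\<^sub>0 'k) set" +
  assumes anti_yetter_drinfeld:
    "coact (act m h) = tensor2 scale scaleM
       (sweedler fscale (\<lambda>(h12, h3).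
          sweedler fscale (\<lambda>(h1, h2).
            sweedler fscale (\<lambda>(a, n). Poly_Mapping.single (antipode h3 * a * h1, act n h2) 1)
              (coact m))
            (comult h12))
          (comult h))"

locale stable_anti_yetter_drinfeld_module =
  anti_yetter_drinfeld_module scale comult counit antipode scaleM act coact
  for scale :: "'k::field \<Rightarrow> 'h::ring_1 \<Rightarrow> 'h"
    and comult :: "'h \<Rightarrow> ('h \<times> 'h \<Rightarrow>\<^sub>0 'k) set" and counit :: "'h \<Rightarrow> 'k" and antipode :: "'h \<Rightarrow> 'h"
    and scaleM :: "'k \<Rightarrow> 'm::ab_group_add \<Rightarrow> 'm"
    and act :: "'m \<Rightarrow> 'h \<Rightarrow> 'm"
    and coact :: "'m \<Rightarrow> ('h \<times> 'm \<Rightarrow>\<^sub>0 'k) set" +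
  assumes stable: "sweedler scaleM (\<lambda>(a, n). act n a) (coact m) = m"


section \<open>Modular pairs in involution\<close>

definition twisted_antipode ::
  "('k::field \<Rightarrow> 'h::ring_1 \<Rightarrow> 'h) \<Rightarrow> ('h \<Rightarrow> ('h \<times> 'h \<Rightarrow>\<^sub>0 'k) set) \<Rightarrow> ('h \<Rightarrow> 'h) \<Rightarrow> ('h \<Rightarrow> 'k) \<Rightarrow> 'h \<Rightarrow> 'h" where
  "twisted_antipode scale comult antipode \<delta> h =
     sweedler scale (\<lambda>(a, b). scale (\<delta> a) (antipode b)) (comult h)"

text \<open>The two-sided inverse of a unit; group-like elements of a Hopf algebra are units.\<close>

definition unit_inverse :: "'h::ring_1 \<Rightarrow> 'h" where
  "unit_inverse u = (THE v. u * v = 1 \<and> v * u = 1)"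

definition modular_pair_in_involution ::
  "('k::field \<Rightarrow> 'h::ring_1 \<Rightarrow> 'h) \<Rightarrow> ('h \<Rightarrow> ('h \<times> 'h \<Rightarrow>\<^sub>0 'k) set) \<Rightarrow> ('h \<Rightarrow> 'k) \<Rightarrow> ('h \<Rightarrow> 'h)
   \<Rightarrow> ('h \<Rightarrow> 'k) \<Rightarrow> 'h \<Rightarrow> bool" where
  "modular_pair_in_involution scale comult counit antipode \<delta> \<sigma> \<longleftrightarrow>
     character scale \<delta> \<and> group_like scale comult counit \<sigma> \<and> \<delta> \<sigma> = 1 \<and>
     (\<forall>h. unit_inverse \<sigma> * twisted_antipode scale comult antipode \<delta>
            (unit_inverse \<sigma> * twisted_antipode scale comult antipode \<delta> h) = h)"

end

theory Submission
  imports Defs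
begin

text \<open>
  For \<open>M = k\<close> the compatibility condition reads \<open>S(h\<^sub>3) \<sigma> h\<^sub>1 \<delta>(h\<^sub>2) = \<delta>(h) \<sigma>\<close>, and stability
  reads \<open>\<delta>(\<sigma>) = 1\<close>. Since \<open>S\<close> is injective and antimultiplicative, applying it turns the former
  into an identity \<open>S * \<delta> * L = \<delta> \<sigma>\<^sup>-\<^sup>1\<close> in the convolution algebra, with \<open>L(h) = \<sigma>\<^sup>-\<^sup>1 S(S(h))\<close>.
  Convolving with the inverse \<open>id\<close> of \<open>S\<close> on the left and with the inverse \<open>\<delta> \<circ> S\<close> of \<open>\<delta>\<close> on the
  right gives the equivalent identity \<open>\<delta>(h\<^sub>1) S(S(h\<^sub>2)) \<delta>(S(h\<^sub>3)) = \<sigma> h \<sigma>\<^sup>-\<^sup>1\<close>, whose left side is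
  the square of the twisted antipode; as the twisted antipode is antimultiplicative and maps
  \<open>\<sigma>\<^sup>-\<^sup>1\<close> to \<open>\<sigma>\<close>, this is the involution property.
\<close>

section \<open>Testing tensors by multilinear functionals\<close>

lemma vector_space_mult: "vector_space ((*) :: 'k::field \<Rightarrow> 'k \<Rightarrow> 'k)"
  by unfold_locales (simp_all add: algebra_simps)

text \<open>Separates \<open>p\<close> from the span: a maximal independent part of \<open>R\<close>
  stays independent when an outside \<open>p\<close> is adjoined, so some functional is 1 at
  \<open>p\<close> and 0 on \<open>R\<close>. Equality in a tensor quotient thus reduces to
  evaluation by functionals that kill the relators.\<close>

lemma in_span_by_functionals:
  fixes sV :: "'k::field \<Rightarrow> 'v::ab_group_add \<Rightarrow> 'v"
  assumes V: "vector_space sV"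
    and test: "\<And>\<phi>. Vector_Spaces.linear sV (*) \<phi> \<Longrightarrow> (\<And>r. r \<in> R \<Longrightarrow> \<phi> r = 0) \<Longrightarrow> \<phi> p = 0"
  shows "p \<in> module.span sV R"
proof (rule ccontr)
  interpret V: vector_space sV by fact
  interpret K: vector_space "(*) :: 'k \<Rightarrow> 'k \<Rightarrow> 'k" by (rule vector_space_mult)
  interpret VK: vector_space_pair sV "(*) :: 'k \<Rightarrow> 'k \<Rightarrow> 'k" ..
  assume p: "p \<notin> V.span R"
  obtain B where B: "B \<subseteq> R" "V.independent B" "R \<subseteq> V.span B"
    by (meson V.maximal_independent_subset)
  have pB: "p \<notin> V.span B"
    using p B(1) V.span_mono by blast
  then have ind: "V.independent (insert p B)"
    using B(2) by (simp add: V.independent_insertI)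
  obtain \<phi> where \<phi>: "Vector_Spaces.linear sV (*) \<phi>"
      "\<forall>x\<in>insert p B. \<phi> x = (if x = p then 1 else 0)"
    using VK.linear_independent_extend[OF ind, of "\<lambda>x. if x = p then 1 else 0"] by blast
  interpret L: Vector_Spaces.linear sV "(*)" \<phi> by (rule \<phi>(1))
  have "\<phi> x = 0" if "x \<in> B" for x
    using \<phi>(2) that pB V.span_base by auto
  then have "\<phi> x = 0" if "x \<in> V.span B" for x
    using L.eq_0_on_span that by blast
  then have "\<phi> p = 0"
    using test \<phi>(1) B(3) by blast
  then show False using \<phi>(2) by simp
qed

text \<open>Expanding \<open>p\<close> in the basis \<open>Poly_Mapping.single x 1\<close> lets a
  functional on formal sums be handled as a function on tuples.\<close>

lemma linear_eq_lin_ext: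
  fixes s :: "'k::field \<Rightarrow> 'v::ab_group_add \<Rightarrow> 'v" and \<phi> :: "('x \<Rightarrow>\<^sub>0 'k) \<Rightarrow> 'v"
  assumes s: "vector_space s" and \<phi>: "Vector_Spaces.linear fscale s \<phi>"
  shows "\<phi> p = lin_ext s (\<lambda>x. \<phi> (Poly_Mapping.single x 1)) p"
proof -
  interpret A: vector_space s by fact
  interpret L: Vector_Spaces.linear fscale s \<phi> by fact
  have "p = (\<Sum>x\<in>Poly_Mapping.keys p. fscale (Poly_Mapping.lookup p x) (Poly_Mapping.single x 1))"
    by (rule poly_mapping_eqI)
       (simp add: lookup_sum lookup_fscale lookup_single when_def in_keys_iff
          if_distrib[where f="(*) _"] cong: if_cong)
  then have "\<phi> p = \<phi> (\<Sum>x\<in>Poly_Mapping.keys p. fscale (Poly_Mapping.lookup p x) (Poly_Mapping.single x 1))"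
    by (rule arg_cong)
  then show ?thesis
    by (simp only: L.sum L.scale lin_ext_def)
qed

text \<open>The two families of relators encode additivity and homogeneity in the slot
  \<open>i\<close>. Applied to every slot, this turns functionals on the quotient into multilinear
  forms.\<close>

lemma linear_if_slot_relators_in_kernel:
  fixes sA :: "'k::field \<Rightarrow> 'a::ab_group_add \<Rightarrow> 'a" and i :: "'a \<Rightarrow> 'x"
  assumes A: "vector_space sA"
    and \<phi>: "Vector_Spaces.linear fscale (*) \<phi>"
    and zero: "\<And>r. r \<in> slot_relators sA i \<Longrightarrow> \<phi> r = 0"
  shows "Vector_Spaces.linear sA (*) (\<lambda>a. \<phi> (Poly_Mapping.single (i a) 1))"
proof -
  interpret L: Vector_Spaces.linear "fscale :: 'k \<Rightarrow> ('x \<Rightarrow>\<^sub>0 'k) \<Rightarrow> _" "(*)" \<phi> by fact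
  \<comment> \<open>The homogeneity relator carries its coefficient inside \<open>single\<close>; it
    is pulled out so that linearity of \<phi> applies.\<close>
  have single: "Poly_Mapping.single x c = fscale c (Poly_Mapping.single x 1)" for x :: 'x and c :: 'k
    by (auto intro!: poly_mapping_eqI simp: lookup_fscale lookup_single when_def)
  have 1: "\<phi> (Poly_Mapping.single (i (x + y)) 1 - Poly_Mapping.single (i x) 1
      - Poly_Mapping.single (i y) 1) = 0" for x y
    by (rule zero) (auto simp: slot_relators_def)
  have 2: "\<phi> (Poly_Mapping.single (i (sA c x)) 1 - Poly_Mapping.single (i x) c) = 0" for c x
    by (rule zero) (auto simp: slot_relators_def)
  show ?thesis
    unfolding Vector_Spaces.linear_iff
  proof (intro conjI allI A vector_space_mult)
    fix x y
    show "\<phi> (Poly_Mapping.single (i (x + y)) 1)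
        = \<phi> (Poly_Mapping.single (i x) 1) + \<phi> (Poly_Mapping.single (i y) 1)"
      using 1[of x y] unfolding L.diff by (simp add: algebra_simps)
  next
    fix c x
    have "\<phi> (Poly_Mapping.single (i x) c) = c * \<phi> (Poly_Mapping.single (i x) 1)"
      by (subst single) (rule L.scale)
    then show "\<phi> (Poly_Mapping.single (i (sA c x)) 1) = c * \<phi> (Poly_Mapping.single (i x) 1)"
      using 2[of c x] by (simp add: L.diff)
  qed
qed

lemma lin_ext_diff:
  assumes "vector_space s"
  shows "lin_ext s f (p - q) = lin_ext s f p - lin_ext s f q"
proof -
  interpret L: Vector_Spaces.linear fscale s "lin_ext s f" by (rule linear_lin_ext[OF assms])
  show ?thesis by (rule L.diff)
qed

lemma lin_ext_add:
  assumes "vector_space s"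
  shows "lin_ext s f (p + q) = lin_ext s f p + lin_ext s f q"
  using linear_lin_ext[OF assms, of f] by (simp add: Vector_Spaces.linear_iff)

lemma lin_ext_fscale:
  assumes "vector_space s"
  shows "lin_ext s f (fscale c p) = s c (lin_ext s f p)"
  using linear_lin_ext[OF assms, of f] by (simp add: Vector_Spaces.linear_iff)

lemma mem_tensor2_self:
  fixes p :: "'a::ab_group_add \<times> 'b::ab_group_add \<Rightarrow>\<^sub>0 'k::field"
  shows "p \<in> tensor2 sA sB p"
proof -
  interpret F: vector_space "fscale :: 'k \<Rightarrow> ('a \<times> 'b \<Rightarrow>\<^sub>0 'k) \<Rightarrow> _" by (rule vector_space_fscale)
  show ?thesis by (simp add: tensor2_def null2_def F.span_zero)
qed

text \<open>A functional that kills the bilinear relators is the linear extension of a bilinear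
  form, so by \<open>in_span_by_functionals\<close> bilinear forms detect cosets.\<close>

lemma mem_tensor2_by_functionals:
  fixes sA :: "'k::field \<Rightarrow> 'a::ab_group_add \<Rightarrow> 'a" and sB :: "'k \<Rightarrow> 'b::ab_group_add \<Rightarrow> 'b"
  assumes A: "vector_space sA" and B: "vector_space sB"
    and test: "\<And>F. (\<And>b. Vector_Spaces.linear sA (*) (\<lambda>a. F (a, b))) \<Longrightarrow>
      (\<And>a. Vector_Spaces.linear sB (*) (\<lambda>b. F (a, b))) \<Longrightarrow> lin_ext (*) F q = lin_ext (*) F p"
  shows "q \<in> tensor2 sA sB p"
proof -
  have "q - p \<in> null2 sA sB"
    unfolding null2_def
  proof (rule in_span_by_functionals[OF vector_space_fscale])
    fix \<phi> :: "('a \<times> 'b \<Rightarrow>\<^sub>0 'k) \<Rightarrow> 'k"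
    assume \<phi>: "Vector_Spaces.linear fscale (*) \<phi>"
      and zero: "\<And>r. r \<in> (\<Union>b. slot_relators sA (\<lambda>a. (a, b))) \<union> (\<Union>a. slot_relators sB (\<lambda>b. (a, b)))
        \<Longrightarrow> \<phi> r = 0"
    have "lin_ext (*) (\<lambda>x. \<phi> (Poly_Mapping.single x 1)) q = lin_ext (*) (\<lambda>x. \<phi> (Poly_Mapping.single x 1)) p"
      by (rule test; rule linear_if_slot_relators_in_kernel[OF _ \<phi>]) (use A B in \<open>auto intro!: zero\<close>)
    then show "\<phi> (q - p) = 0"
      by (simp add: linear_eq_lin_ext[OF vector_space_mult \<phi>, of "q - p"] lin_ext_diff[OF vector_space_mult])
  qed
  then show ?thesis by (simp add: tensor2_def)
qed

lemma tensor2_eq: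
  fixes p q :: "'a::ab_group_add \<times> 'b::ab_group_add \<Rightarrow>\<^sub>0 'k::field"
  assumes "q \<in> tensor2 sA sB p"
  shows "tensor2 sA sB q = tensor2 sA sB p"
proof -
  interpret F: vector_space "fscale :: 'k \<Rightarrow> ('a \<times> 'b \<Rightarrow>\<^sub>0 'k) \<Rightarrow> _" by (rule vector_space_fscale)
  have qp: "q - p \<in> null2 sA sB" using assms by (simp add: tensor2_def)
  have "r - q \<in> null2 sA sB \<longleftrightarrow> r - p \<in> null2 sA sB" for r
    using qp F.span_add[of "r - q" _ "q - p"] F.span_diff[of "r - p" _ "q - p"]
    unfolding null2_def by (auto simp: algebra_simps)
  then show ?thesis by (simp add: tensor2_def)
qed

lemma tensor3_eq_by_functionals:
  fixes sA :: "'k::field \<Rightarrow> 'a::ab_group_add \<Rightarrow> 'a" and sB :: "'k \<Rightarrow> 'b::ab_group_add \<Rightarrow> 'b"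
    and sC :: "'k \<Rightarrow> 'c::ab_group_add \<Rightarrow> 'c"
  assumes A: "vector_space sA" and B: "vector_space sB" and C: "vector_space sC"
    and test: "\<And>F. (\<And>b c. Vector_Spaces.linear sA (*) (\<lambda>a. F (a, b, c))) \<Longrightarrow>
      (\<And>a c. Vector_Spaces.linear sB (*) (\<lambda>b. F (a, b, c))) \<Longrightarrow>
      (\<And>a b. Vector_Spaces.linear sC (*) (\<lambda>c. F (a, b, c))) \<Longrightarrow> lin_ext (*) F q = lin_ext (*) F p"
  shows "tensor3 sA sB sC q = tensor3 sA sB sC p"
proof -
  interpret F: vector_space "fscale :: 'k \<Rightarrow> ('a \<times> 'b \<times> 'c \<Rightarrow>\<^sub>0 'k) \<Rightarrow> _" by (rule vector_space_fscale)
  have qp: "q - p \<in> null3 sA sB sC"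
    unfolding null3_def
  proof (rule in_span_by_functionals[OF vector_space_fscale])
    fix \<phi> :: "('a \<times> 'b \<times> 'c \<Rightarrow>\<^sub>0 'k) \<Rightarrow> 'k"
    assume \<phi>: "Vector_Spaces.linear fscale (*) \<phi>"
      and zero: "\<And>r. r \<in> (\<Union>b c. slot_relators sA (\<lambda>a. (a, b, c)))
        \<union> (\<Union>a c. slot_relators sB (\<lambda>b. (a, b, c))) \<union> (\<Union>a b. slot_relators sC (\<lambda>c. (a, b, c)))
        \<Longrightarrow> \<phi> r = 0"
    have "lin_ext (*) (\<lambda>x. \<phi> (Poly_Mapping.single x 1)) q = lin_ext (*) (\<lambda>x. \<phi> (Poly_Mapping.single x 1)) p"
      by (rule test; rule linear_if_slot_relators_in_kernel[OF _ \<phi>]) (use A B C in \<open>auto intro!: zero\<close>)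
    then show "\<phi> (q - p) = 0"
      by (simp add: linear_eq_lin_ext[OF vector_space_mult \<phi>, of "q - p"] lin_ext_diff[OF vector_space_mult])
  qed
  have "r - q \<in> null3 sA sB sC \<longleftrightarrow> r - p \<in> null3 sA sB sC" for r
    using qp F.span_add[of "r - q" _ "q - p"] F.span_diff[of "r - p" _ "q - p"]
    unfolding null3_def by (auto simp: algebra_simps)
  then show ?thesis by (simp add: tensor3_def)
qed

text \<open>Trilinear maps kill the relators of \<open>null3\<close> and so factor through the
  quotient. This makes the axiom \<open>coassoc\<close> usable under Sweedler sums.\<close>

lemma lin_ext_tensor3_cong:
  fixes s :: "'k::field \<Rightarrow> 'v::ab_group_add \<Rightarrow> 'v"
    and sA :: "'k \<Rightarrow> 'a::ab_group_add \<Rightarrow> 'a" and sB :: "'k \<Rightarrow> 'b::ab_group_add \<Rightarrow> 'b"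
    and sC :: "'k \<Rightarrow> 'c::ab_group_add \<Rightarrow> 'c"
  assumes s: "vector_space s"
    and f1: "\<And>b c. Vector_Spaces.linear sA s (\<lambda>a. f (a, b, c))"
    and f2: "\<And>a c. Vector_Spaces.linear sB s (\<lambda>b. f (a, b, c))"
    and f3: "\<And>a b. Vector_Spaces.linear sC s (\<lambda>c. f (a, b, c))"
    and eq: "tensor3 sA sB sC p = tensor3 sA sB sC q"
  shows "lin_ext s f p = lin_ext s f q"
proof -
  interpret A: vector_space s by fact
  interpret F: vector_space "fscale :: 'k \<Rightarrow> ('a \<times> 'b \<times> 'c \<Rightarrow>\<^sub>0 'k) \<Rightarrow> _" by (rule vector_space_fscale)
  have "p \<in> tensor3 sA sB sC p" by (simp add: tensor3_def null3_def F.span_zero)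
  then have "p - q \<in> null3 sA sB sC" unfolding eq by (simp add: tensor3_def)
  then have "lin_ext s f p - lin_ext s f q \<in> {0}"
    unfolding null3_def
  proof (rule lin_ext_cong_mod[OF s, rotated 2])
    fix r
    assume r: "r \<in> (\<Union>b c. slot_relators sA (\<lambda>a. (a, b, c)))
        \<union> (\<Union>a c. slot_relators sB (\<lambda>b. (a, b, c))) \<union> (\<Union>a b. slot_relators sC (\<lambda>c. (a, b, c)))"
    have "f (x + y, b, c) = f (x, b, c) + f (y, b, c)" "f (sA k x, b, c) = s k (f (x, b, c))"
      for x y b c k using f1[of b c] by (simp_all add: Vector_Spaces.linear_iff)
    moreover have "f (a, x + y, c) = f (a, x, c) + f (a, y, c)" "f (a, sB k x, c) = s k (f (a, x, c))"
      for x y a c k using f2[of a c] by (simp_all add: Vector_Spaces.linear_iff)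
    moreover have "f (a, b, x + y) = f (a, b, x) + f (a, b, y)" "f (a, b, sC k x) = s k (f (a, b, x))"
      for x y a b k using f3[of a b] by (simp_all add: Vector_Spaces.linear_iff)
    ultimately show "lin_ext s f r \<in> {0}"
      using r s by (auto simp: slot_relators_def lin_ext_diff[OF s])
  qed (rule A.subspace_single_0)
  then show ?thesis by simp
qed

section \<open>Evaluation, linearity and exchange of Sweedler sums\<close>

lemma sweedler_representative:
  assumes s: "vector_space s"
    and f1: "\<And>b. Vector_Spaces.linear sA s (\<lambda>a. f (a, b))"
    and f2: "\<And>a. Vector_Spaces.linear sB s (\<lambda>b. f (a, b))"
    and t: "t \<in> range (tensor2 sA sB)" and p: "p \<in> t"
  shows "sweedler s f t = lin_ext s f p"
proof -
  from t obtain p0 where "t = tensor2 sA sB p0" by blast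
  then have "t = tensor2 sA sB p" using p by (simp add: tensor2_eq)
  then show ?thesis by (simp add: sweedler_tensor2[OF s f1 f2])
qed

text \<open>Both sides sum over the same chosen representative of \<open>t\<close>, so
  \<open>L\<close> only has to pass through a finite sum.\<close>

lemma linear_sweedler:
  assumes L: "Vector_Spaces.linear s s' L"
  shows "L (sweedler s g t) = sweedler s' (\<lambda>x. L (g x)) t"
proof -
  interpret L: Vector_Spaces.linear s s' L by fact
  show ?thesis by (simp add: sweedler_def lin_ext_def L.sum L.scale)
qed

lemma lin_ext_sweedler:
  assumes "vector_space s"
  shows "lin_ext s f (sweedler fscale g t) = sweedler s (\<lambda>x. lin_ext s f (g x)) t"
  by (rule linear_sweedler[OF linear_lin_ext[OF assms]])

lemma sweedler_swap:
  assumes "vector_space s"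
  shows "sweedler s (\<lambda>x. sweedler s (\<lambda>y. f x y) t) u = sweedler s (\<lambda>y. sweedler s (\<lambda>x. f x y) u) t"
proof -
  interpret vector_space s by fact
  show ?thesis
    unfolding sweedler_def lin_ext_def
    by (simp add: scale_sum_right mult.commute)
       (rule sum.swap)
qed

lemma linear_sweedler_param:
  assumes V: "vector_space sV" and s: "vector_space s"
    and f: "\<And>x. Vector_Spaces.linear sV s (\<lambda>v. f v x)"
  shows "Vector_Spaces.linear sV s (\<lambda>v. sweedler s (f v) t)"
proof -
  interpret vector_space s by fact
  show ?thesis
    using f unfolding sweedler_def lin_ext_def Vector_Spaces.linear_iff
    by (auto simp: scale_right_distrib sum.distrib scale_sum_right mult.commute V s)
qed

section \<open>Sweedler calculus in a Hopf algebra\<close>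

context hopf_algebra
begin

text \<open>The expression \<open>F(h1, h2)\<close> of Sweedler notation; nesting it gives iterated
  coproducts. The scalar multiplication is a parameter because values in \<open>H\<close> and in
  \<open>k\<close> both occur.\<close>

definition sw :: "('k \<Rightarrow> 'v::ab_group_add \<Rightarrow> 'v) \<Rightarrow> ('h \<Rightarrow> 'h \<Rightarrow> 'v) \<Rightarrow> 'h \<Rightarrow> 'v" where
  "sw s F h = sweedler s (\<lambda>(a, b). F a b) (comult h)"

abbreviation lin :: "('h \<Rightarrow> 'h) \<Rightarrow> bool" where
  "lin \<equiv> Vector_Spaces.linear scale scale"

section \<open>Closure rules for linearity\<close>

lemma lin_ident: "lin (\<lambda>x. x)"
  by (simp add: Vector_Spaces.linear_iff vector_space_axioms)

lemma lin_mult_left: "lin f \<Longrightarrow> lin (\<lambda>x. c * f x)"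
  by (simp add: Vector_Spaces.linear_iff distrib_left scale_mult_right)

lemma lin_mult_right: "lin f \<Longrightarrow> lin (\<lambda>x. f x * c)"
  by (simp add: Vector_Spaces.linear_iff distrib_right scale_mult_left)

lemma lin_scale: "lin f \<Longrightarrow> lin (\<lambda>x. scale c (f x))"
  by (simp add: Vector_Spaces.linear_iff scale_right_distrib scale_left_commute)

lemma lin_antipode: "lin f \<Longrightarrow> lin (\<lambda>x. antipode (f x))"
  using antipode_linear by (simp add: Vector_Spaces.linear_iff)

lemma lin_scale_functional:
  "Vector_Spaces.linear scale (*) \<phi> \<Longrightarrow> lin f \<Longrightarrow> lin (\<lambda>x. scale (\<phi> (f x)) c)"
  by (simp add: Vector_Spaces.linear_iff scale_left_distrib)

text \<open>By \<open>comult_linear\<close>, sums and multiples of representatives again represent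
  coproducts; bilinearity of \<open>F\<close> allows \<open>sw\<close> to be computed on exactly
  these representatives.\<close>

lemma linear_sw:
  assumes s: "vector_space s"
    and F1: "\<And>b. Vector_Spaces.linear scale s (\<lambda>a. F a b)"
    and F2: "\<And>a. Vector_Spaces.linear scale s (\<lambda>b. F a b)"
  shows "Vector_Spaces.linear scale s (sw s F)"
proof -
  have rng: "comult x \<in> range (tensor2 scale scale)"
    and add: "p \<in> comult x \<Longrightarrow> q \<in> comult y \<Longrightarrow> p + q \<in> comult (x + y)"
    and scal: "p \<in> comult x \<Longrightarrow> fscale c p \<in> comult (scale c x)" for x y p q c
    using comult_linear by (auto simp: linear_to_tensor_def)
  have rep: "sw s F x = lin_ext s (\<lambda>(a, b). F a b) p" if "p \<in> comult x" for x p
    unfolding sw_def using F1 F2 that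
    by (intro sweedler_representative[OF s _ _ rng]) auto
  have ex: "\<exists>p. p \<in> comult x" for x
    using rng[of x] mem_tensor2_self by (metis rangeE)
  show ?thesis
    unfolding Vector_Spaces.linear_iff
  proof (intro conjI allI s vector_space_axioms)
    fix x y
    obtain p q where "p \<in> comult x" "q \<in> comult y" using ex by blast
    with add[OF this] show "sw s F (x + y) = sw s F x + sw s F y"
      by (simp add: rep lin_ext_add[OF s])
  next
    fix c x
    obtain p where "p \<in> comult x" using ex by blast
    then show "sw s F (scale c x) = s c (sw s F x)"
      by (simp add: rep[OF scal] rep lin_ext_fscale[OF s])
  qed
qed

lemma lin_sw:
  assumes "\<And>b. lin (\<lambda>a. F a b)" "\<And>a. lin (\<lambda>b. F a b)" "lin f"
  shows "lin (\<lambda>x. sw scale F (f x))"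
  using linear_sw[OF vector_space_axioms assms(1,2)] assms(3) by (simp add: Vector_Spaces.linear_iff)

lemma linear_sw_param:
  assumes V: "vector_space sV" and s: "vector_space s"
    and f: "\<And>a b. Vector_Spaces.linear sV s (\<lambda>v. F v a b)"
  shows "Vector_Spaces.linear sV s (\<lambda>v. sw s (F v) h)"
  unfolding sw_def by (rule linear_sweedler_param[OF V s]) (use f in auto)

lemma lin_sw_param: "(\<And>a b. lin (\<lambda>x. F x a b)) \<Longrightarrow> lin (\<lambda>x. sw scale (F x) h)"
  by (rule linear_sw_param[OF vector_space_axioms vector_space_axioms])

text \<open>These settle the multilinearity premises of the Sweedler rules by following the shape of
  the term.\<close>

lemmas lin_intros = lin_ident lin_mult_left lin_mult_right lin_scale lin_antipode
  lin_scale_functional[OF counit_linear] lin_sw_param lin_sw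

section \<open>The Hopf algebra axioms as rules for Sweedler sums\<close>

lemma linear_sw_apply:
  "Vector_Spaces.linear s s' L \<Longrightarrow> L (sw s F h) = sw s' (\<lambda>a b. L (F a b)) h"
  unfolding sw_def by (subst linear_sweedler) (auto simp: case_prod_unfold)

lemma sw_mult_left: "c * sw scale F h = sw scale (\<lambda>a b. c * F a b) h"
  by (rule linear_sw_apply) (intro lin_intros)

lemma sw_mult_right: "sw scale F h * c = sw scale (\<lambda>a b. F a b * c) h"
  by (rule linear_sw_apply[where L="\<lambda>x. x * c"]) (intro lin_intros)

lemma sw_scale: "scale c (sw scale F h) = sw scale (\<lambda>a b. scale c (F a b)) h"
  by (rule linear_sw_apply) (intro lin_intros)

lemma sw_antipode: "antipode (sw scale F h) = sw scale (\<lambda>a b. antipode (F a b)) h"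
  by (rule linear_sw_apply[OF antipode_linear])

lemma sw_swap:
  "sw scale (\<lambda>a b. sw scale (\<lambda>c d. F a b c d) y) x = sw scale (\<lambda>c d. sw scale (\<lambda>a b. F a b c d) x) y"
  unfolding sw_def case_prod_unfold
  by (rule sweedler_swap[OF vector_space_axioms])

text \<open>Evaluating the trilinear map \<open>G\<close> on the two formal sums in
  \<open>coassoc\<close> gives the iterated sums once \<open>lin_ext\<close> is pushed inside
  \<open>sweedler\<close>.\<close>

lemma sw_coassoc:
  assumes s: "vector_space s"
    and G: "\<And>b c. Vector_Spaces.linear scale s (\<lambda>a. G a b c)"
      "\<And>a c. Vector_Spaces.linear scale s (\<lambda>b. G a b c)"
      "\<And>a b. Vector_Spaces.linear scale s (\<lambda>c. G a b c)"
  shows "sw s (\<lambda>a b. sw s (\<lambda>a1 a2. G a1 a2 b) a) x = sw s (\<lambda>a b. sw s (\<lambda>b1 b2. G a b1 b2) b) x"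
proof -
  interpret S: vector_space s by fact
  have "lin_ext s (\<lambda>(a, b, c). G a b c)
      (sweedler fscale (\<lambda>(a, b). sweedler fscale (\<lambda>(a1, a2). Poly_Mapping.single (a1, a2, b) 1) (comult a)) (comult x))
    = lin_ext s (\<lambda>(a, b, c). G a b c)
      (sweedler fscale (\<lambda>(a, b). sweedler fscale (\<lambda>(b1, b2). Poly_Mapping.single (a, b1, b2) 1) (comult b)) (comult x))"
    by (rule lin_ext_tensor3_cong[OF s _ _ _ coassoc]) (use G in auto)
  then show ?thesis
    by (simp add: lin_ext_sweedler[OF s] sw_def case_prod_unfold s)
qed

lemma sw_mult:
  assumes s: "vector_space s"
    and F: "\<And>b. Vector_Spaces.linear scale s (\<lambda>a. F a b)"
      "\<And>a. Vector_Spaces.linear scale s (\<lambda>b. F a b)"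
  shows "sw s F (x * y) = sw s (\<lambda>a b. sw s (\<lambda>c d. F (a * c) (b * d)) y) x"
proof -
  interpret S: vector_space s by fact
  show ?thesis
    unfolding sw_def comult_mult
    by (subst sweedler_tensor2[OF s]) (simp_all add: F lin_ext_sweedler[OF s] case_prod_unfold s)
qed

lemma sw_group_like:
  assumes s: "vector_space s" and g: "comult g = tensor2 scale scale (Poly_Mapping.single (g, g) 1)"
    and F: "\<And>b. Vector_Spaces.linear scale s (\<lambda>a. F a b)"
      "\<And>a. Vector_Spaces.linear scale s (\<lambda>b. F a b)"
  shows "sw s F g = F g g"
proof -
  interpret S: vector_space s by fact
  show ?thesis
    unfolding sw_def g
    by (subst sweedler_tensor2[OF s]) (simp_all add: F s)
qed

lemma sw_counit_left:
  assumes "lin L"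
  shows "sw scale (\<lambda>a b. scale (counit a) (L b)) x = L x"
proof -
  have "L (sw scale (\<lambda>a b. scale (counit a) b) x) = sw scale (\<lambda>a b. L (scale (counit a) b)) x"
    by (rule linear_sw_apply[OF assms])
  then show ?thesis
    using assms counit_left[of x] by (simp add: sw_def Vector_Spaces.linear_iff)
qed

lemma sw_counit_right:
  assumes "lin L"
  shows "sw scale (\<lambda>a b. scale (counit b) (L a)) x = L x"
proof -
  have "L (sw scale (\<lambda>a b. scale (counit b) a) x) = sw scale (\<lambda>a b. L (scale (counit b) a)) x"
    by (rule linear_sw_apply[OF assms])
  then show ?thesis
    using assms counit_right[of x] by (simp add: sw_def Vector_Spaces.linear_iff)
qed

lemma sw_antipode_left: "sw scale (\<lambda>a b. antipode a * b) x = scale (counit x) 1"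
  using antipode_left by (simp add: sw_def)

lemma sw_antipode_right: "sw scale (\<lambda>a b. a * antipode b) x = scale (counit x) 1"
  using antipode_right by (simp add: sw_def)

section \<open>The antipode as a unital antihomomorphism\<close>

text \<open>The unit is group-like, so the antipode axiom at \<open>1\<close> has the single term
  \<open>S(1) 1\<close>.\<close>

lemma antipode_one: "antipode 1 = 1"
proof -
  have "sw scale (\<lambda>a b. antipode a * b) 1 = antipode 1 * 1"
    by (rule sw_group_like[OF vector_space_axioms comult_one]) (intro lin_intros)+
  then show ?thesis by (simp add: sw_antipode_left counit_one)
qed

text \<open>Both sides are evaluations of \<open>S(x\<^sub>1 y\<^sub>1) x\<^sub>2 y\<^sub>2 S(y\<^sub>3) S(x\<^sub>3)\<close>.\<close>

lemma antipode_mult: "antipode (x * y) = antipode y * antipode x"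
proof -
  \<comment> \<open>Coassociativity pairs the second and third legs of \<open>y\<close>, and
    \<open>y2 S(y3)\<close> collapses to a counit.\<close>
  have y: "sw scale (\<lambda>c d. sw scale (\<lambda>c1 c2. antipode (a1 * c1) * (a2 * c2) * (antipode d * antipode b)) c) y
      = antipode (a1 * y) * (a2 * antipode b)" for a1 a2 b
  proof -
    have "sw scale (\<lambda>c d. sw scale (\<lambda>c1 c2. antipode (a1 * c1) * (a2 * c2) * (antipode d * antipode b)) c) y
        = sw scale (\<lambda>c d. sw scale (\<lambda>d1 d2. antipode (a1 * c) * (a2 * d1) * (antipode d2 * antipode b)) d) y"
      by (rule sw_coassoc[OF vector_space_axioms]) (intro lin_intros)+
    also have "\<dots> = sw scale (\<lambda>c d. antipode (a1 * c) * a2 * sw scale (\<lambda>d1 d2. d1 * antipode d2) d * antipode b) y"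
      by (simp add: sw_mult_left sw_mult_right mult.assoc)
    also have "\<dots> = sw scale (\<lambda>c d. scale (counit d) (antipode (a1 * c) * (a2 * antipode b))) y"
      by (simp add: sw_antipode_right scale_mult_left scale_mult_right mult.assoc)
    also have "\<dots> = antipode (a1 * y) * (a2 * antipode b)"
      by (rule sw_counit_right) (intro lin_intros)
    finally show ?thesis .
  qed
  \<comment> \<open>The antipode axiom at the product \<open>a * c\<close> produces the counits,
    since coproduct and counit are multiplicative.\<close>
  have inner: "scale (counit a) (scale (counit c) (antipode d * antipode b))
      = sw scale (\<lambda>a1 a2. sw scale (\<lambda>c1 c2. antipode (a1 * c1) * (a2 * c2) * (antipode d * antipode b)) c) a"
    for a b c d
  proof -
    have "sw scale (\<lambda>a1 a2. sw scale (\<lambda>c1 c2. antipode (a1 * c1) * (a2 * c2)) c) a = scale (counit (a * c)) 1"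
      unfolding sw_antipode_left[symmetric]
      by (rule sw_mult[OF vector_space_axioms, symmetric]) (intro lin_intros)+
    then have "sw scale (\<lambda>a1 a2. sw scale (\<lambda>c1 c2. antipode (a1 * c1) * (a2 * c2)) c) a * (antipode d * antipode b)
      = scale (counit (a * c)) (antipode d * antipode b)"
      by (simp add: scale_mult_left)
    then show ?thesis by (simp add: sw_mult_right counit_mult)
  qed
  \<comment> \<open>Counits are inserted and expanded by \<open>inner\<close>; after an exchange of
    sums the same expression is collapsed from the other end, first in \<open>y\<close> and then in
    \<open>x\<close>.\<close>
  have "antipode y * antipode x
      = sw scale (\<lambda>a b. scale (counit a) (sw scale (\<lambda>c d. scale (counit c) (antipode d * antipode b)) y)) x"
    by (subst sw_counit_left, (intro lin_intros)+)+ simp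
  also have "\<dots> = sw scale (\<lambda>a b. sw scale (\<lambda>c d. sw scale (\<lambda>a1 a2.
      sw scale (\<lambda>c1 c2. antipode (a1 * c1) * (a2 * c2) * (antipode d * antipode b)) c) a) y) x"
    by (simp only: sw_scale inner)
  also have "\<dots> = sw scale (\<lambda>a b. sw scale (\<lambda>a1 a2. antipode (a1 * y) * (a2 * antipode b)) a) x"
    by (subst sw_swap) (simp add: y)
  also have "\<dots> = sw scale (\<lambda>a b. sw scale (\<lambda>b1 b2. antipode (a * y) * (b1 * antipode b2)) b) x"
    by (rule sw_coassoc[OF vector_space_axioms]) (intro lin_intros)+
  also have "\<dots> = sw scale (\<lambda>a b. scale (counit b) (antipode (a * y))) x"
    by (simp add: sw_mult_left[symmetric] sw_antipode_right scale_mult_right)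
  also have "\<dots> = antipode (x * y)"
    by (rule sw_counit_right) (intro lin_intros)
  finally show ?thesis by simp
qed

section \<open>Convolution\<close>

definition conv :: "('h \<Rightarrow> 'h) \<Rightarrow> ('h \<Rightarrow> 'h) \<Rightarrow> 'h \<Rightarrow> 'h" where
  "conv f g h = sw scale (\<lambda>a b. f a * g b) h"

text \<open>Convolution with respect to the co-opposite comultiplication.\<close>

definition coconv :: "('h \<Rightarrow> 'h) \<Rightarrow> ('h \<Rightarrow> 'h) \<Rightarrow> 'h \<Rightarrow> 'h" where
  "coconv f g h = sw scale (\<lambda>a b. f b * g a) h"

text \<open>The map \<eta> \<circ> \<epsilon>, the unit of both convolution products.\<close>

definition conv_unit :: "'h \<Rightarrow> 'h" where
  "conv_unit h = scale (counit h) 1"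

lemma lin_conv: "lin f \<Longrightarrow> lin g \<Longrightarrow> lin (conv f g)"
  unfolding conv_def[abs_def] by (intro lin_intros)

lemma lin_coconv: "lin f \<Longrightarrow> lin g \<Longrightarrow> lin (coconv f g)"
  unfolding coconv_def[abs_def] by (intro lin_intros)

lemma conv_assoc:
  assumes "lin f" "lin g" "lin k"
  shows "conv (conv f g) k = conv f (conv g k)"
proof
  fix h
  have "sw scale (\<lambda>a b. sw scale (\<lambda>a1 a2. f a1 * g a2 * k b) a) h
      = sw scale (\<lambda>a b. sw scale (\<lambda>b1 b2. f a * g b1 * k b2) b) h"
    by (rule sw_coassoc[OF vector_space_axioms]) (intro lin_intros assms)+
  then show "conv (conv f g) k h = conv f (conv g k) h"
    by (simp add: conv_def sw_mult_left sw_mult_right mult.assoc)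
qed

text \<open>Here the left bracketing splits the second leg of the coproduct, so coassociativity
  enters in the direction opposite to \<open>conv_assoc\<close>.\<close>

lemma coconv_assoc:
  assumes "lin f" "lin g" "lin k"
  shows "coconv (coconv f g) k = coconv f (coconv g k)"
proof
  fix h
  have "sw scale (\<lambda>a b. sw scale (\<lambda>a1 a2. f b * g a2 * k a1) a) h
      = sw scale (\<lambda>a b. sw scale (\<lambda>b1 b2. f b2 * g b1 * k a) b) h"
    by (rule sw_coassoc[OF vector_space_axioms]) (intro lin_intros assms)+
  then show "coconv (coconv f g) k h = coconv f (coconv g k) h"
    by (simp add: coconv_def sw_mult_left sw_mult_right mult.assoc)
qed

lemma conv_units:
  assumes "lin f"
  shows "conv conv_unit f = f" "conv f conv_unit = f"
    and "coconv conv_unit f = f" "coconv f conv_unit = f"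
  by (rule ext; simp add: conv_def coconv_def conv_unit_def scale_mult_left scale_mult_right
        sw_counit_left[OF assms] sw_counit_right[OF assms])+

lemma conv_antipode_left: "conv antipode (\<lambda>x. x) = conv_unit"
  by (rule ext) (simp add: conv_def conv_unit_def sw_antipode_left)

lemma conv_antipode_right: "conv (\<lambda>x. x) antipode = conv_unit"
  by (rule ext) (simp add: conv_def conv_unit_def sw_antipode_right)

text \<open>By antimultiplicativity \<open>S(h2) S(S(h1))\<close> equals \<open>S(S(h1) h2)\<close>,
  which is \<open>S\<close> applied to the antipode axiom.\<close>

lemma coconv_antipode_antipode:
  "coconv antipode (\<lambda>x. antipode (antipode x)) = conv_unit"
proof
  fix h
  have "coconv antipode (\<lambda>x. antipode (antipode x)) h = antipode (sw scale (\<lambda>a b. antipode a * b) h)"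
    by (simp add: coconv_def sw_antipode antipode_mult)
  then show "coconv antipode (\<lambda>x. antipode (antipode x)) h = conv_unit h"
    using antipode_linear
    by (simp add: sw_antipode_left conv_unit_def Vector_Spaces.linear_iff antipode_one)
qed

end

section \<open>Characters and group-like elements\<close>

locale hopf_character_group_like = hopf_algebra scale comult counit antipode
  for scale :: "'k::field \<Rightarrow> 'h::ring_1 \<Rightarrow> 'h"
    and comult :: "'h \<Rightarrow> ('h \<times> 'h \<Rightarrow>\<^sub>0 'k) set" and counit :: "'h \<Rightarrow> 'k" and antipode :: "'h \<Rightarrow> 'h" +
  fixes \<delta> :: "'h \<Rightarrow> 'k" and \<sigma> :: 'h
  assumes char: "character scale \<delta>"
    and group_like: "group_like scale comult counit \<sigma>"
begin

abbreviation \<tau> :: 'h where "\<tau> \<equiv> antipode \<sigma>"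
text \<open>The functionals \<delta> and \<delta> \<circ> S are carried into \<open>H\<close> as
  multiples of \<open>1\<close>, so that they can be convolved with the antipode; their values are
  central.\<close>

abbreviation D :: "'h \<Rightarrow> 'h" where "D h \<equiv> scale (\<delta> h) 1"
abbreviation D' :: "'h \<Rightarrow> 'h" where "D' h \<equiv> scale (\<delta> (antipode h)) 1"
abbreviation SS :: "'h \<Rightarrow> 'h" where "SS h \<equiv> antipode (antipode h)"
abbreviation T :: "'h \<Rightarrow> 'h" where "T \<equiv> twisted_antipode scale comult antipode \<delta>"

lemma char_linear: "Vector_Spaces.linear scale (*) \<delta>"
  and char_one: "\<delta> 1 = 1"
  and char_mult: "\<delta> (x * y) = \<delta> x * \<delta> y"
  using char by (auto simp: character_def)

lemmas lin_char_intros = lin_intros lin_scale_functional[OF char_linear]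

lemma group_like_sw:
  assumes "vector_space s" "\<And>b. Vector_Spaces.linear scale s (\<lambda>a. F a b)"
    "\<And>a. Vector_Spaces.linear scale s (\<lambda>b. F a b)"
  shows "sw s F \<sigma> = F \<sigma> \<sigma>"
  using sw_group_like[OF assms(1) _ assms(2,3)] group_like by (simp add: group_like_def)

text \<open>The antipode axioms at \<sigma>, whose coproduct has one term and whose counit is
  1.\<close>

lemma sigma_inverse: "\<sigma> * \<tau> = 1" "\<tau> * \<sigma> = 1"
proof -
  have "sw scale (\<lambda>a b. a * antipode b) \<sigma> = \<sigma> * \<tau>" "sw scale (\<lambda>a b. antipode a * b) \<sigma> = \<tau> * \<sigma>"
    by (rule group_like_sw[OF vector_space_axioms]; intro lin_intros)+
  then show "\<sigma> * \<tau> = 1" "\<tau> * \<sigma> = 1"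
    using group_like by (simp_all add: sw_antipode_left sw_antipode_right group_like_def)
qed

lemma unit_inverse_sigma: "unit_inverse \<sigma> = \<tau>"
  unfolding unit_inverse_def
proof (rule the_equality)
  show "\<sigma> * \<tau> = 1 \<and> \<tau> * \<sigma> = 1" using sigma_inverse by simp
next
  fix v assume v: "\<sigma> * v = 1 \<and> v * \<sigma> = 1"
  have "v = v * (\<sigma> * \<tau>)" by (simp add: sigma_inverse)
  also have "\<dots> = (v * \<sigma>) * \<tau>" by (simp only: mult.assoc)
  finally show "v = \<tau>" using v by simp
qed

text \<open>Applying the multiplicative \<delta> to the antipode axioms gives the convolution
  inverse. Scalar values commute, which also yields the identity with the legs exchanged.\<close>

lemma D_inverse:
  "conv D D' = conv_unit" "conv D' D = conv_unit" "coconv D D' = conv_unit"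
proof -
  have L: "lin D" by (intro lin_char_intros)
  have unit: "D (scale (counit h) 1) = conv_unit h" for h
    using char_linear by (simp add: Vector_Spaces.linear_iff char_one conv_unit_def)
  have *: "sw scale (\<lambda>a b. D (antipode a * b)) h = conv_unit h" for h
    by (simp only: linear_sw_apply[OF L, symmetric] sw_antipode_left unit)
  have **: "sw scale (\<lambda>a b. D (a * antipode b)) h = conv_unit h" for h
    by (simp only: linear_sw_apply[OF L, symmetric] sw_antipode_right unit)
  show "conv D D' = conv_unit"
    by (rule ext) (simp add: conv_def scale_mult_left **[symmetric] char_mult)
  show "conv D' D = conv_unit"
    by (rule ext) (simp add: conv_def scale_mult_left *[symmetric] char_mult)
  show "coconv D D' = conv_unit"
    by (rule ext) (simp add: coconv_def scale_mult_right *[symmetric] char_mult)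
qed

section \<open>The twisted antipode\<close>

lemma T_conv: "T = conv D antipode"
  by (rule ext) (simp add: twisted_antipode_def conv_def sw_def scale_mult_left)

lemma lin_D: "lin D" and lin_D': "lin D'" and lin_SS: "lin SS" and lin_S: "lin antipode" and lin_T: "lin T"
  unfolding T_conv by (intro lin_char_intros lin_conv)+

text \<open>Inherited from the antipode: \<delta> is multiplicative and its scalar values move
  freely past the reversed factors.\<close>

lemma T_mult: "T (x * y) = T y * T x"
proof -
  have "T (x * y) = sw scale (\<lambda>a b. scale (\<delta> a) (antipode b)) (x * y)"
    by (simp add: T_conv conv_def scale_mult_left)
  also have "\<dots> = sw scale (\<lambda>a b. sw scale (\<lambda>c d. scale (\<delta> (a * c)) (antipode (b * d))) y) x"
    by (rule sw_mult[OF vector_space_axioms]) (intro lin_char_intros)+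
  also have "\<dots> = sw scale (\<lambda>a b. sw scale (\<lambda>c d. scale (\<delta> c) (antipode d)) y * scale (\<delta> a) (antipode b)) x"
    by (simp only: sw_mult_right sw_scale scale_mult_left scale_mult_right scale_scale char_mult antipode_mult)
  also have "\<dots> = T y * T x"
    by (simp only: sw_mult_left[symmetric]) (simp add: T_conv conv_def scale_mult_left)
  finally show ?thesis .
qed

lemma T_one: "T 1 = 1"
  unfolding T_conv conv_def
  by (subst sw_group_like[OF vector_space_axioms comult_one])
     ((intro lin_char_intros)+, simp add: char_one antipode_one)

text \<open>Group-likeness gives \<open>T \<sigma> = \<delta>(\<sigma>) \<tau> = \<tau>\<close>;
  antimultiplicativity at \<open>\<sigma> * \<tau> = 1\<close> then makes \<open>T \<tau>\<close> a
  left inverse of \<tau>.\<close>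

lemma T_tau:
  assumes "\<delta> \<sigma> = 1"
  shows "T \<tau> = \<sigma>"
proof -
  have "T \<sigma> = \<tau>"
    unfolding T_conv conv_def
    by (subst group_like_sw[OF vector_space_axioms])
       ((intro lin_char_intros)+, simp add: assms)
  then have "T \<tau> * \<tau> = 1"
    using T_mult[of \<sigma> \<tau>] by (simp add: sigma_inverse T_one)
  then have "T \<tau> * (\<tau> * \<sigma>) = \<sigma>" by (simp add: mult.assoc[symmetric])
  then show ?thesis by (simp add: sigma_inverse)
qed

text \<open>Both sides are inverse to \<open>T\<close> under \<^const>\<open>coconv\<close>; this avoids the
  anti-comultiplicativity of the antipode.\<close>

lemma T_antipode: "(\<lambda>h. T (antipode h)) = conv SS D'"
proof -
  have lin_TS: "lin (\<lambda>h. T (antipode h))"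
    using lin_T lin_S by (simp add: Vector_Spaces.linear_iff)
  \<comment> \<open>Antimultiplicativity of \<open>T\<close> turns \<open>T(S(h2)) T(h1)\<close>
    into \<open>T(h1 S(h2))\<close>.\<close>
  have left: "coconv (\<lambda>h. T (antipode h)) T = conv_unit"
  proof
    fix h
    have "coconv (\<lambda>h. T (antipode h)) T h = T (sw scale (\<lambda>a b. a * antipode b) h)"
      by (simp add: coconv_def linear_sw_apply[OF lin_T] T_mult)
    also have "\<dots> = scale (counit h) (T 1)"
      using lin_T by (simp add: sw_antipode_right Vector_Spaces.linear_iff)
    finally show "coconv (\<lambda>h. T (antipode h)) T h = conv_unit h" by (simp add: conv_unit_def T_one)
  qed
  \<comment> \<open>Scalar factors may change sides, so both maps become \<open>coconv\<close>
    products in which \<open>D\<close> meets its inverse \<open>D'\<close>.\<close>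
  have T: "T = coconv antipode D" and Q: "conv SS D' = coconv D' SS"
    unfolding T_conv by (auto simp: conv_def coconv_def scale_mult_left scale_mult_right)
  have "coconv T (conv SS D') = coconv antipode (coconv (coconv D D') SS)"
    unfolding T Q by (simp add: coconv_assoc lin_coconv lin_S lin_D lin_D' lin_SS)
  also have "\<dots> = conv_unit"
    by (simp add: D_inverse conv_units lin_SS coconv_antipode_antipode)
  finally have right: "coconv T (conv SS D') = conv_unit" .
  \<comment> \<open>A left inverse and a right inverse of \<open>T\<close> agree by
    associativity.\<close>
  have "coconv (coconv (\<lambda>h. T (antipode h)) T) (conv SS D')
      = coconv (\<lambda>h. T (antipode h)) (coconv T (conv SS D'))"
    by (intro coconv_assoc lin_TS lin_T lin_conv lin_SS lin_D')
  then show ?thesis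
    by (simp add: left right conv_units lin_TS lin_conv lin_SS lin_D')
qed

section \<open>From the compatibility condition to the involution condition\<close>

lemma conv_condition_iff_involution:
  assumes "\<delta> \<sigma> = 1"
  shows "conv (conv D (\<lambda>h. \<tau> * SS h)) D' = (\<lambda>h. h * \<tau>) \<longleftrightarrow> (\<forall>h. \<tau> * T (\<tau> * T h) = h)"
proof -
  let ?Z = "conv (conv D (\<lambda>h. \<tau> * SS h)) D'"
  \<comment> \<open>The outer \<open>T\<close> passes into the sum defining the inner one, where
    \<open>T_antipode\<close> applies.\<close>
  have "T (T h) = conv D (conv SS D') h" for h
  proof -
    have "T (T h) = T (sw scale (\<lambda>a b. scale (\<delta> a) (antipode b)) h)"
      by (simp add: T_conv conv_def scale_mult_left)
    also have "\<dots> = sw scale (\<lambda>a b. T (scale (\<delta> a) (antipode b))) h"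
      by (rule linear_sw_apply[OF lin_T])
    also have "\<dots> = sw scale (\<lambda>a b. scale (\<delta> a) (T (antipode b))) h"
      using lin_T by (simp add: Vector_Spaces.linear_iff)
    also have "\<dots> = conv D (conv SS D') h"
      unfolding T_antipode[symmetric] conv_def by (simp add: scale_mult_left)
    finally show ?thesis .
  qed
  moreover have "?Z h = \<tau> * conv D (conv SS D') h" for h
  proof -
    have "?Z = conv D (conv (\<lambda>h. \<tau> * SS h) D')"
      by (intro conv_assoc lin_char_intros)
    then show ?thesis
      by (simp add: conv_def sw_mult_left scale_mult_left scale_mult_right mult.assoc sw_scale)
  qed
  \<comment> \<open>By \<open>T_mult\<close> and \<open>T_tau\<close>, the inner \<tau> reappears as
    a right factor \<sigma>, to be cancelled by \<tau>.\<close>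
  ultimately have Z: "\<tau> * T (\<tau> * T h) = ?Z h * \<sigma>" for h
    by (simp add: T_mult T_tau[OF assms] mult.assoc)
  have "x * \<sigma> = h \<longleftrightarrow> x = h * \<tau>" for x h
    by (auto simp: mult.assoc sigma_inverse)
  then show ?thesis by (simp add: Z fun_eq_iff)
qed

text \<open>Only invertible factors are cancelled: the identity map against the antipode on the
  left, and \<open>D\<close> against \<open>D'\<close> on the right.\<close>

lemma antipode_condition_iff_conv:
  "conv (conv antipode D) (\<lambda>h. \<tau> * SS h) = (\<lambda>h. scale (\<delta> h) \<tau>)
    \<longleftrightarrow> conv (conv D (\<lambda>h. \<tau> * SS h)) D' = (\<lambda>h. h * \<tau>)"
    (is "conv (conv _ _) ?L = ?M \<longleftrightarrow> _")
proof
  have lin_L: "lin ?L" and lin_M: "lin ?M" and lin_R: "lin (\<lambda>h. h * \<tau>)"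
    by (intro lin_char_intros)+
  \<comment> \<open>Both sides are \<open>h1 \<delta>(h2) \<tau>\<close>; the second form exposes
    the right factor \<open>D\<close>.\<close>
  have id_M: "conv (\<lambda>x. x) ?M = conv (\<lambda>h. h * \<tau>) D"
    by (rule ext) (simp add: conv_def scale_mult_right)
  {
    assume E: "conv (conv antipode D) ?L = ?M"
    have "conv D ?L = conv (conv (\<lambda>x. x) antipode) (conv D ?L)"
      by (simp add: conv_antipode_right conv_units lin_conv lin_D lin_L)
    also have "\<dots> = conv (\<lambda>x. x) (conv (conv antipode D) ?L)"
      by (simp add: conv_assoc lin_conv lin_ident lin_S lin_D lin_L)
    finally have "conv D ?L = conv (\<lambda>h. h * \<tau>) D"
      by (simp add: E id_M)
    then show "conv (conv D ?L) D' = (\<lambda>h. h * \<tau>)"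
      by (simp add: conv_assoc D_inverse conv_units lin_R lin_D lin_D')
  next
    assume E: "conv (conv D ?L) D' = (\<lambda>h. h * \<tau>)"
    have "conv D ?L = conv (conv (conv D ?L) D') D"
      by (simp add: conv_assoc[where f="conv D ?L"] D_inverse conv_units lin_conv lin_D lin_D' lin_L)
    then have *: "conv D ?L = conv (\<lambda>x. x) ?M"
      by (simp add: E id_M)
    have "conv (conv antipode D) ?L = conv antipode (conv D ?L)"
      by (intro conv_assoc lin_S lin_D lin_L)
    also have "\<dots> = conv (conv antipode (\<lambda>x. x)) ?M"
      unfolding * by (intro conv_assoc[symmetric] lin_S lin_ident lin_M)
    finally show "conv (conv antipode D) ?L = ?M"
      by (simp add: conv_antipode_left conv_units lin_M)
  }
qed

text \<open>The antipode reverses \<open>S(h3) \<sigma> h1\<close> into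
  \<open>S(h1) \<tau> S(S(h3))\<close>, restoring coproduct order, and injectivity allows the
  return.\<close>

lemma scalar_ayd_iff_conv:
  assumes "inj antipode"
  shows "(\<forall>h. sw scale (\<lambda>h12 h3. sw scale (\<lambda>h1 h2. scale (\<delta> h2) (antipode h3 * \<sigma> * h1)) h12) h
      = scale (\<delta> h) \<sigma>)
    \<longleftrightarrow> conv (conv antipode D) (\<lambda>h. \<tau> * SS h) = (\<lambda>h. scale (\<delta> h) \<tau>)"
proof -
  have S_scale: "antipode (scale c x) = scale c (antipode x)" for c x
    using antipode_linear by (simp add: Vector_Spaces.linear_iff)
  have "antipode (sw scale (\<lambda>h12 h3. sw scale (\<lambda>h1 h2. scale (\<delta> h2) (antipode h3 * \<sigma> * h1)) h12) h)
      = conv (conv antipode D) (\<lambda>h. \<tau> * SS h) h" for h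
    by (simp add: conv_def sw_antipode sw_mult_right S_scale antipode_mult scale_mult_left scale_mult_right mult.assoc)
  moreover have "antipode (scale (\<delta> h) \<sigma>) = scale (\<delta> h) \<tau>" for h
    by (rule S_scale)
  ultimately show ?thesis
    unfolding fun_eq_iff by (subst inj_eq[OF assms, symmetric]) simp
qed

section \<open>The ground field as a module-comodule\<close>

lemma sweedler_coact:
  fixes s :: "'k \<Rightarrow> 'v::ab_group_add \<Rightarrow> 'v"
  assumes s: "vector_space s"
    and f: "\<And>b. Vector_Spaces.linear scale s (\<lambda>a. f (a, b))"
      "\<And>a. Vector_Spaces.linear (*) s (\<lambda>b. f (a, b))"
  shows "sweedler s f (tensor2 scale (*) (Poly_Mapping.single (\<sigma>, m) 1)) = f (\<sigma>, m)"
proof -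
  interpret S: vector_space s by fact
  show ?thesis by (subst sweedler_tensor2[OF s]) (use f s in auto)
qed

text \<open>Evaluates a bilinear map on the right side of the compatibility condition, where the sum
  over the coaction has the single term \<open>(\<sigma>, m)\<close>.\<close>

lemma lin_ext_ayd:
  fixes s :: "'k \<Rightarrow> 'v::ab_group_add \<Rightarrow> 'v"
  assumes s: "vector_space s"
    and f: "\<And>b. Vector_Spaces.linear scale s (\<lambda>a. f (a, b))"
      "\<And>a. Vector_Spaces.linear (*) s (\<lambda>b. f (a, b))"
  shows "lin_ext s f (sweedler fscale (\<lambda>(h12, h3).
          sweedler fscale (\<lambda>(h1, h2).
            sweedler fscale (\<lambda>(a, n). Poly_Mapping.single (antipode h3 * a * h1, n * \<delta> h2) 1)
              (tensor2 scale (*) (Poly_Mapping.single (\<sigma>, m) 1)))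
            (comult h12))
          (comult h))
     = sw s (\<lambda>h12 h3. sw s (\<lambda>h1 h2. f (antipode h3 * \<sigma> * h1, m * \<delta> h2)) h12) h"
proof -
  interpret S: vector_space s by fact
  have "sweedler s (\<lambda>(a, n). f (antipode h3 * a * h1, n * \<delta> h2))
      (tensor2 scale (*) (Poly_Mapping.single (\<sigma>, m) 1)) = f (antipode h3 * \<sigma> * h1, m * \<delta> h2)" for h1 h2 h3
    using f by (subst sweedler_coact[OF s])
      (auto simp: Vector_Spaces.linear_iff distrib_left distrib_right scale_mult_left scale_mult_right
        mult.assoc S.scale_right_distrib S.scale_left_distrib)
  then show ?thesis
    by (simp add: sw_def lin_ext_sweedler[OF s] case_prod_unfold s)
qed

text \<open>Rests on H \<otimes> k being H: the canonical map extracts the identity in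
  \<open>H\<close>, and bilinear forms on \<open>H\<close> and \<open>k\<close>, being functionals
  on \<open>H\<close>, carry it back.\<close>

lemma ayd_iff_scalar:
  "(\<forall>m h. tensor2 scale (*) (Poly_Mapping.single (\<sigma>, m * \<delta> h) 1) = tensor2 scale (*)
       (sweedler fscale (\<lambda>(h12, h3).
          sweedler fscale (\<lambda>(h1, h2).
            sweedler fscale (\<lambda>(a, n). Poly_Mapping.single (antipode h3 * a * h1, n * \<delta> h2) 1)
              (tensor2 scale (*) (Poly_Mapping.single (\<sigma>, m) 1)))
            (comult h12))
          (comult h)))
   \<longleftrightarrow> (\<forall>h. sw scale (\<lambda>h12 h3. sw scale (\<lambda>h1 h2. scale (\<delta> h2) (antipode h3 * \<sigma> * h1)) h12) h
        = scale (\<delta> h) \<sigma>)"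
  (is "(\<forall>m h. tensor2 scale (*) (?l m h) = tensor2 scale (*) (?r m h)) \<longleftrightarrow> (\<forall>h. ?w h = _)")
proof
  assume ayd: "\<forall>m h. tensor2 scale (*) (?l m h) = tensor2 scale (*) (?r m h)"
  \<comment> \<open>This induces the canonical isomorphism from H \<otimes> k to H; it is applied
    below at \<open>m = 1\<close>.\<close>
  let ?\<mu> = "\<lambda>(a, n). scale n a"
  have \<mu>: "Vector_Spaces.linear scale scale (\<lambda>a. ?\<mu> (a, b))"
      "Vector_Spaces.linear (*) scale (\<lambda>b. ?\<mu> (a, b))" for a b
    by (auto simp: Vector_Spaces.linear_iff scale_right_distrib scale_left_distrib mult.commute
        vector_space_axioms vector_space_mult)
  show "\<forall>h. ?w h = scale (\<delta> h) \<sigma>"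
  proof
    fix h
    have "lin_ext scale ?\<mu> (?l 1 h) = lin_ext scale ?\<mu> (?r 1 h)"
      by (simp only: sweedler_tensor2[OF vector_space_axioms \<mu>, symmetric] ayd[rule_format])
    then show "?w h = scale (\<delta> h) \<sigma>"
      unfolding lin_ext_ayd[OF vector_space_axioms \<mu>] by (simp add: vector_space_axioms)
  qed
next
  assume w: "\<forall>h. ?w h = scale (\<delta> h) \<sigma>"
  show "\<forall>m h. tensor2 scale (*) (?l m h) = tensor2 scale (*) (?r m h)"
  proof (intro allI tensor2_eq mem_tensor2_by_functionals vector_space_axioms vector_space_mult)
    fix m h and F :: "'h \<times> 'k \<Rightarrow> 'k"
    assume F: "\<And>b. Vector_Spaces.linear scale (*) (\<lambda>a. F (a, b))"
      "\<And>a. Vector_Spaces.linear (*) (*) (\<lambda>b. F (a, b))"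
    \<comment> \<open>A bilinear form with second argument in \<open>k\<close> is determined by its
      values at \<open>1\<close>.\<close>
    have F1: "F (a, c) = c * F (a, 1)" for a c
    proof -
      have "F (a, c * 1) = c * F (a, 1)"
        using F(2)[of a] by (simp only: Vector_Spaces.linear_iff)
      then show ?thesis by simp
    qed
    have L: "Vector_Spaces.linear scale (*) (\<lambda>a. m * F (a, 1))"
      using F(1)[of 1] by (simp add: Vector_Spaces.linear_iff algebra_simps)
    \<comment> \<open>The functional sending \<open>a\<close> to \<open>m * F (a, 1)\<close> is
      moved inside the iterated Sweedler sum.\<close>
    have "m * F (?w h, 1) = sw (*) (\<lambda>h12 h3. sw (*) (\<lambda>h1 h2. m * F (scale (\<delta> h2) (antipode h3 * \<sigma> * h1), 1)) h12) h"
      by (simp add: linear_sw_apply[OF L])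
    also have "\<dots> = lin_ext (*) F (?r m h)"
    proof -
      have "m * F (scale c a, 1) = F (a, m * c)" for a c
        using F(1)[of 1] F1[of a "m * c"] by (simp add: Vector_Spaces.linear_iff)
      then show ?thesis by (simp add: lin_ext_ayd[OF vector_space_mult F])
    qed
    finally have "lin_ext (*) F (?r m h) = m * F (scale (\<delta> h) \<sigma>, 1)" using w by simp
    also have "\<dots> = F (\<sigma>, m * \<delta> h)"
      using F(1)[of 1] F1[of \<sigma> "m * \<delta> h"] by (simp add: Vector_Spaces.linear_iff)
    finally show "lin_ext (*) F (?l m h) = lin_ext (*) F (?r m h)"
      by (simp add: vector_space_mult)
  qed
qed

lemma linear_coact:
  "linear_to_tensor (*) scale (*) (\<lambda>m. tensor2 scale (*) (Poly_Mapping.single (\<sigma>, m) 1))"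
proof -
  \<comment> \<open>The condition ranges over all members of the coset, so the value of
    \<open>F\<close> is computed for an arbitrary one.\<close>
  have val: "lin_ext (*) F p = F (\<sigma>, m)"
    if p: "p \<in> tensor2 scale (*) (Poly_Mapping.single (\<sigma>, m) 1)"
      and F: "\<And>b. Vector_Spaces.linear scale (*) (\<lambda>a. F (a, b))"
        "\<And>a. Vector_Spaces.linear (*) (*) (\<lambda>b. F (a, b))"
    for p m and F :: "'h \<times> 'k \<Rightarrow> 'k"
    using sweedler_coact[OF vector_space_mult F] sweedler_representative[OF vector_space_mult F _ p]
    by simp
  show ?thesis
    unfolding linear_to_tensor_def
  proof (intro conjI allI ballI rangeI mem_tensor2_by_functionals vector_space_axioms vector_space_mult)
    fix v w p q and F :: "'h \<times> 'k \<Rightarrow> 'k"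
    assume pq: "p \<in> tensor2 scale (*) (Poly_Mapping.single (\<sigma>, v) 1)"
        "q \<in> tensor2 scale (*) (Poly_Mapping.single (\<sigma>, w) 1)"
      and F: "\<And>b. Vector_Spaces.linear scale (*) (\<lambda>a. F (a, b))"
        "\<And>a. Vector_Spaces.linear (*) (*) (\<lambda>b. F (a, b))"
    show "lin_ext (*) F (p + q) = lin_ext (*) F (Poly_Mapping.single (\<sigma>, v + w) 1)"
      using F(2)[of \<sigma>]
      by (simp add: lin_ext_add vector_space_mult val[OF pq(1) F] val[OF pq(2) F] Vector_Spaces.linear_iff)
  next
    fix c v p and F :: "'h \<times> 'k \<Rightarrow> 'k"
    assume p: "p \<in> tensor2 scale (*) (Poly_Mapping.single (\<sigma>, v) 1)"
      and F: "\<And>b. Vector_Spaces.linear scale (*) (\<lambda>a. F (a, b))"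
        "\<And>a. Vector_Spaces.linear (*) (*) (\<lambda>b. F (a, b))"
    show "lin_ext (*) F (fscale c p) = lin_ext (*) F (Poly_Mapping.single (\<sigma>, c * v) 1)"
      using F(2)[of \<sigma>]
      by (simp add: lin_ext_fscale vector_space_mult val[OF p F] Vector_Spaces.linear_iff)
  qed
qed

text \<open>Every trilinear form takes the value \<open>F (\<sigma>, \<sigma>, m)\<close> on both
  sides: on the left because \<sigma> is group-like, on the right by coacting twice.\<close>

lemma coassoc_coact:
  "tensor3 scale scale (*)
     (sweedler fscale (\<lambda>(a, n). sweedler fscale (\<lambda>(a1, a2). Poly_Mapping.single (a1, a2, n) 1) (comult a))
       (tensor2 scale (*) (Poly_Mapping.single (\<sigma>, m) 1)))
   = tensor3 scale scale (*)
     (sweedler fscale (\<lambda>(a, n). sweedler fscale (\<lambda>(b, n'). Poly_Mapping.single (a, b, n') 1)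
         (tensor2 scale (*) (Poly_Mapping.single (\<sigma>, n) 1)))
       (tensor2 scale (*) (Poly_Mapping.single (\<sigma>, m) 1)))"
proof (rule tensor3_eq_by_functionals[OF vector_space_axioms vector_space_axioms vector_space_mult])
  fix F :: "'h \<times> 'h \<times> 'k \<Rightarrow> 'k"
  assume F: "\<And>b c. Vector_Spaces.linear scale (*) (\<lambda>a. F (a, b, c))"
    "\<And>a c. Vector_Spaces.linear scale (*) (\<lambda>b. F (a, b, c))"
    "\<And>a b. Vector_Spaces.linear (*) (*) (\<lambda>c. F (a, b, c))"
  let ?c = "\<lambda>m. tensor2 scale (*) (Poly_Mapping.single (\<sigma>, m) 1)"
  have "sweedler (*) (\<lambda>(a, n). sw (*) (\<lambda>a1 a2. F (a1, a2, n)) a) (?c m) = F (\<sigma>, \<sigma>, m)"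
    by (subst sweedler_coact[OF vector_space_mult])
       (simp_all add: F linear_sw linear_sw_param group_like_sw vector_space_mult)
  moreover have "sweedler (*) (\<lambda>(b, n'). F (a, b, n')) (?c n) = F (a, \<sigma>, n)" for a n
    by (subst sweedler_coact[OF vector_space_mult]) (simp_all add: F)
  moreover have "sweedler (*) (\<lambda>(a, n). F (a, \<sigma>, n)) (?c m) = F (\<sigma>, \<sigma>, m)"
    by (subst sweedler_coact[OF vector_space_mult]) (simp_all add: F)
  ultimately show "lin_ext (*) F
     (sweedler fscale (\<lambda>(a, n). sweedler fscale (\<lambda>(a1, a2). Poly_Mapping.single (a1, a2, n) 1) (comult a)) (?c m))
   = lin_ext (*) F
     (sweedler fscale (\<lambda>(a, n). sweedler fscale (\<lambda>(b, n'). Poly_Mapping.single (a, b, n') 1) (?c n)) (?c m))"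
    by (simp add: lin_ext_sweedler[OF vector_space_mult] sw_def case_prod_unfold vector_space_mult)
qed

lemma stable_coact_iff:
  "(\<forall>m. sweedler (*) (\<lambda>(a, n). n * \<delta> a) (tensor2 scale (*) (Poly_Mapping.single (\<sigma>, m) 1)) = m)
    \<longleftrightarrow> \<delta> \<sigma> = 1"
proof -
  have "sweedler (*) (\<lambda>(a, n). n * \<delta> a) (tensor2 scale (*) (Poly_Mapping.single (\<sigma>, m) 1)) = m * \<delta> \<sigma>" for m
    using char_linear
    by (subst sweedler_coact[OF vector_space_mult])
       (simp_all add: Vector_Spaces.linear_iff distrib_left distrib_right mult.assoc mult.left_commute)
  moreover have "(\<forall>m. m * \<delta> \<sigma> = m) \<longleftrightarrow> \<delta> \<sigma> = 1"
    by (auto dest: spec[of _ 1])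
  ultimately show ?thesis by simp
qed

lemma ground_field_right_module:
  "hopf_right_module scale comult counit antipode (*) (\<lambda>m h. m * \<delta> h)"
proof -
  have "Vector_Spaces.linear (*) (*) (\<lambda>m. m * \<delta> h)" for h
    by (simp add: Vector_Spaces.linear_iff vector_space_mult distrib_right)
  moreover have "Vector_Spaces.linear scale (*) (\<lambda>h. m * \<delta> h)" for m
    using char_linear by (simp add: Vector_Spaces.linear_iff distrib_left mult.left_commute)
  ultimately show ?thesis
    unfolding hopf_right_module_def hopf_right_module_axioms_def
    by (simp only: hopf_algebra_axioms vector_space_mult char_one char_mult mult.assoc mult_1_right
        simp_thms)
qed

lemma ground_field_left_comodule:
  "hopf_left_comodule scale comult counit antipode (*)
    (\<lambda>m. tensor2 scale (*) (Poly_Mapping.single (\<sigma>, m) 1))"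
proof -
  have "sweedler (*) (\<lambda>(a, n). counit a * n) (tensor2 scale (*) (Poly_Mapping.single (\<sigma>, m) 1)) = m" for m
    using counit_linear group_like
    by (subst sweedler_coact[OF vector_space_mult])
       (simp_all add: Vector_Spaces.linear_iff distrib_left distrib_right mult.assoc mult.left_commute
         group_like_def)
  then show ?thesis
    unfolding hopf_left_comodule_def hopf_left_comodule_axioms_def
    using hopf_algebra_axioms vector_space_mult linear_coact coassoc_coact by blast
qed

theorem stable_ayd_iff_modular_pair:
  assumes "inj antipode"
  shows "stable_anti_yetter_drinfeld_module scale comult counit antipode (*) (\<lambda>m h. m * \<delta> h)
      (\<lambda>m. tensor2 scale (*) (Poly_Mapping.single (\<sigma>, m) 1))
    \<longleftrightarrow> modular_pair_in_involution scale comult counit antipode \<delta> \<sigma>"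
proof -
  \<comment> \<open>The module and comodule parts are established above; compatibility becomes the
    convolution identity and stability becomes \<open>\<delta> \<sigma> = 1\<close>.\<close>
  have "stable_anti_yetter_drinfeld_module scale comult counit antipode (*) (\<lambda>m h. m * \<delta> h)
      (\<lambda>m. tensor2 scale (*) (Poly_Mapping.single (\<sigma>, m) 1))
    \<longleftrightarrow> conv (conv D (\<lambda>h. \<tau> * SS h)) D' = (\<lambda>h. h * \<tau>) \<and> \<delta> \<sigma> = 1"
    unfolding stable_anti_yetter_drinfeld_module_def stable_anti_yetter_drinfeld_module_axioms_def
      anti_yetter_drinfeld_module_def anti_yetter_drinfeld_module_axioms_def
      stable_coact_iff ayd_iff_scalar scalar_ayd_iff_conv[OF assms] antipode_condition_iff_conv
    using ground_field_right_module ground_field_left_comodule by blast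
  \<comment> \<open>Both sides contain \<open>\<delta> \<sigma> = 1\<close>, under which the
    convolution identity is the involution condition.\<close>
  also have "\<dots> \<longleftrightarrow> modular_pair_in_involution scale comult counit antipode \<delta> \<sigma>"
    unfolding modular_pair_in_involution_def unit_inverse_sigma
    using conv_condition_iff_involution char group_like by blast
  finally show ?thesis .
qed

end

theorem lemma2p2:
  fixes scale :: "'k::field \<Rightarrow> 'h::ring_1 \<Rightarrow> 'h"
    and comult :: "'h \<Rightarrow> ('h \<times> 'h \<Rightarrow>\<^sub>0 'k) set"
    and counit :: "'h \<Rightarrow> 'k"
    and antipode :: "'h \<Rightarrow> 'h"
    and \<delta> :: "'h \<Rightarrow> 'k"
    and \<sigma> :: 'h
  assumes "hopf_algebra scale comult counit antipode"
    and "bij antipode"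
    and "character scale \<delta>"
    and "group_like scale comult counit \<sigma>"
  shows "stable_anti_yetter_drinfeld_module scale comult counit antipode
           ((*) :: 'k \<Rightarrow> 'k \<Rightarrow> 'k)
           (\<lambda>m h. m * \<delta> h)
           (\<lambda>m. tensor2 scale (*) (Poly_Mapping.single (\<sigma>, m) 1))
         \<longleftrightarrow> modular_pair_in_involution scale comult counit antipode \<delta> \<sigma>"
proof -
  interpret hopf_character_group_like scale comult counit antipode \<delta> \<sigma>
    using assms(1,3,4)
    by (simp add: hopf_character_group_like_def hopf_character_group_like_axioms_def)
  show ?thesis
    by (rule stable_ayd_iff_modular_pair) (use assms(2) in \<open>rule bij_is_inj\<close>)
qed

end
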